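(* Let $A_1,A_2$ be the $6\times6$ matrices over $\mathbb{R}_{\max}$ whose only entries different from $\varepsilon=-\infty$ are the following. For $A_1$: $(A_1)_{1,2}=(A_1)_{2,1}=0$ and $(A_1)_{1,3}=(A_1)_{2,5}=(A_1)_{3,4}=(A_1)_{4,1}=(A_1)_{5,6}=(A_1)_{6,2}=-100$. For $A_2$: $(A_2)_{1,2}=(A_2)_{2,1}=0$, $(A_2)_{1,3}=(A_2)_{3,4}=(A_2)_{5,6}=(A_2)_{6,2}=-100$ and $(A_2)_{2,5}=(A_2)_{4,1}=-1$. (Their common associated digraph is primitive, and their common critical digraph is the cycle $1\to2\to1$, of cyclicity $2$.) Then for every $t\ge2$ the product $(A_1)^{2t}\otimes A_2$ is not CSR, and for every $t\ge1$ the product $(A_1)^{2t+1}\otimes A_2$ is not CSR. Consequently, there are arbitrarily long products of matrices from $\{A_1,A_2\}$ that are not CSR.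
   Context: $\mathbb{R}_{\max}=\mathbb{R}\cup\{-\infty\}$ with $a\oplus b=\max(a,b)$, $a\otimes b=a+b$; $(A\otimes B)_{i,j}=\max_l(a_{i,l}+b_{l,j})$; matrix powers are tropical and $A^0=I$ ($0$ on the diagonal, $\varepsilon$ elsewhere). The digraph associated with a square matrix $A$ has an edge $(i,j)$ of weight $a_{i,j}$ iff $a_{i,j}\ne\varepsilon$. The critical digraph of $A$ consists of all nodes and edges on cycles whose mean weight (weight/length) is maximal. The cyclicity of a strongly connected digraph is the gcd of its cycle lengths; it is primitive if this is $1$. CSR: let $\mathcal{E}_c$ be the edge set of the common critical digraph of the matrices in the set, $\gamma$ its cyclicity, $S$ the matrix with $S_{i,j}=0$ for $(i,j)\in\mathcal{E}_c$ and $\varepsilon$ otherwise, $T(S)$ the least $T$ with $S^{l+\gamma}=S^l$ for all $l\ge T$, and $t_0$ any integer with $t_0\gamma\ge T(S)$. For a product $\Gamma(k)$ of $k$ matrices from the set, and $k\,(\mathrm{mod}\,\gamma)\in\{0,\dots,\gamma-1\}$, put $C=\Gamma(k)\otimes S^{(t_0+1)\gamma-k(\mathrm{mod}\,\gamma)}$ and $R=S^{(t_0+1)\gamma-k(\mathrm{mod}\,\gamma)}\otimes\Gamma(k)$. $\Gamma(k)$ is called CSR if $\Gamma(k)=C\otimes S^{k(\mathrm{mod}\,\gamma)}\otimes R$. *)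

theory Defs
  imports "HOL-Analysis.Analysis" "Graph_Theory.Graph_Theory"
begin

section \<open>The max-plus semiring\<close>

text \<open>
  The semiring \<open>\<real>\<^sub>m\<^sub>a\<^sub>x\<close> is made an instance of \<^class>\<open>comm_semiring_1\<close>, so that the library's matrix
  product \<open>**\<close> and identity matrix \<open>mat 1\<close> over it are the tropical ones. Beware that the class
  constants are then the tropical ones: \<open>0 :: rmax\<close> is \<open>\<epsilon>\<close> and \<open>1 :: rmax\<close> is the real number zero.
\<close>

datatype rmax = Eps (\<open>\<epsilon>\<close>) | Fin (the_real: real)

instantiation rmax :: comm_semiring_1
begin

fun plus_rmax :: "rmax \<Rightarrow> rmax \<Rightarrow> rmax" where
  "\<epsilon> + y = y"
| "x + \<epsilon> = x"
| "Fin a + Fin b = Fin (max a b)"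

fun times_rmax :: "rmax \<Rightarrow> rmax \<Rightarrow> rmax" where
  "\<epsilon> * y = \<epsilon>"
| "x * \<epsilon> = \<epsilon>"
| "Fin a * Fin b = Fin (a + b)"

definition zero_rmax :: rmax where "0 = \<epsilon>"
definition one_rmax :: rmax where "1 = Fin 0"

instance
proof
  fix a b c :: rmax
  show "a + b + c = a + (b + c)" by (cases a; cases b; cases c) (auto simp: max.assoc)
  show "a + b = b + a" by (cases a; cases b) (auto simp: max.commute)
  show "0 + a = a" by (simp add: zero_rmax_def)
  show "a * b * c = a * (b * c)" by (cases a; cases b; cases c) auto
  show "a * b = b * a" by (cases a; cases b) auto
  show "1 * a = a" by (cases a) (auto simp: one_rmax_def)
  show "0 * a = 0" by (simp add: zero_rmax_def)
  show "a * 0 = 0" by (cases a) (auto simp: zero_rmax_def)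
  show "(a + b) * c = a * c + b * c" by (cases a; cases b; cases c) (auto simp: max_def)
  show "(0 :: rmax) \<noteq> 1" by (simp add: zero_rmax_def one_rmax_def)
qed

end

text \<open>The type class power \<open>A ^ k\<close> on vectors is entrywise, hence the following definition.\<close>

primrec matpow :: "rmax^'n^'n \<Rightarrow> nat \<Rightarrow> rmax^'n^'n" where
  "matpow A 0 = mat 1"
| "matpow A (Suc k) = A ** matpow A k"

definition products :: "(rmax^'n^'n) set \<Rightarrow> nat \<Rightarrow> (rmax^'n^'n) set" where
  "products X k = {foldr (**) w (mat 1) | w. length w = k \<and> set w \<subseteq> X}"

section \<open>Associated and critical digraphs\<close>

definition assoc_digraph :: "rmax^'n^'n \<Rightarrow> ('n, 'n \<times> 'n) pre_digraph" where
  "assoc_digraph A = \<lparr>verts = UNIV, arcs = {(i, j). A $ i $ j \<noteq> \<epsilon>}, tail = fst, head = snd\<rparr>"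

definition cycle_mean :: "rmax^'n^'n \<Rightarrow> ('n \<times> 'n) awalk \<Rightarrow> real" where
  "cycle_mean A p = (\<Sum>(i, j)\<leftarrow>p. the_real (A $ i $ j)) / real (length p)"

definition critical_cycle :: "rmax^'n^'n \<Rightarrow> ('n \<times> 'n) awalk \<Rightarrow> bool" where
  "critical_cycle A p \<longleftrightarrow> pre_digraph.cycle (assoc_digraph A) p \<and>
     (\<forall>q. pre_digraph.cycle (assoc_digraph A) q \<longrightarrow> cycle_mean A q \<le> cycle_mean A p)"

definition critical_digraph :: "rmax^'n^'n \<Rightarrow> ('n, 'n \<times> 'n) pre_digraph" where
  "critical_digraph A =
     \<lparr>verts = {v. \<exists>p e. critical_cycle A p \<and> e \<in> set p \<and> (v = fst e \<or> v = snd e)},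
      arcs = {e. \<exists>p. critical_cycle A p \<and> e \<in> set p},
      tail = fst, head = snd\<rparr>"

text \<open>Meant for strongly connected digraphs only.\<close>

definition cyclicity :: "('a, 'b) pre_digraph \<Rightarrow> nat" where
  "cyclicity G = Gcd {length p | p. pre_digraph.cycle G p}"

definition primitive_digraph :: "('a, 'b) pre_digraph \<Rightarrow> bool" where
  "primitive_digraph G \<longleftrightarrow> strongly_connected G \<and> cyclicity G = 1"

section \<open>CSR\<close>

text \<open>Meant for nonempty sets of matrices that all have the same critical digraph.\<close>

definition common_critical_digraph :: "(rmax^'n^'n) set \<Rightarrow> ('n, 'n \<times> 'n) pre_digraph" where
  "common_critical_digraph X = (THE D. \<forall>A\<in>X. critical_digraph A = D)"

definition CSR_gamma :: "(rmax^'n^'n) set \<Rightarrow> nat" where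
  "CSR_gamma X = cyclicity (common_critical_digraph X)"

definition CSR_S :: "(rmax^'n^'n) set \<Rightarrow> rmax^'n^'n" where
  "CSR_S X = (\<chi> i j. if (i, j) \<in> arcs (common_critical_digraph X) then Fin 0 else \<epsilon>)"

definition CSR_T :: "(rmax^'n^'n) set \<Rightarrow> nat" where
  "CSR_T X = (LEAST T. \<forall>l\<ge>T. matpow (CSR_S X) (l + CSR_gamma X) = matpow (CSR_S X) l)"

text \<open>
  Since \<open>CSR_T X\<close> is nonnegative, an admissible integer \<open>t\<^sub>0\<close> is nonnegative as soon as the cyclicity
  is positive, so it is taken to be a natural number.
\<close>

definition CSR_admissible :: "(rmax^'n^'n) set \<Rightarrow> nat \<Rightarrow> bool" where
  "CSR_admissible X t\<^sub>0 \<longleftrightarrow> CSR_T X \<le> t\<^sub>0 * CSR_gamma X"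

definition CSR_C :: "(rmax^'n^'n) set \<Rightarrow> nat \<Rightarrow> nat \<Rightarrow> rmax^'n^'n \<Rightarrow> rmax^'n^'n" where
  "CSR_C X t\<^sub>0 k \<Gamma> = \<Gamma> ** matpow (CSR_S X) ((t\<^sub>0 + 1) * CSR_gamma X - k mod CSR_gamma X)"

definition CSR_R :: "(rmax^'n^'n) set \<Rightarrow> nat \<Rightarrow> nat \<Rightarrow> rmax^'n^'n \<Rightarrow> rmax^'n^'n" where
  "CSR_R X t\<^sub>0 k \<Gamma> = matpow (CSR_S X) ((t\<^sub>0 + 1) * CSR_gamma X - k mod CSR_gamma X) ** \<Gamma>"

text \<open>The number \<open>k\<close> of factors is an argument because it cannot be read off from the matrix \<open>\<Gamma>\<close>.\<close>

definition is_CSR :: "(rmax^'n^'n) set \<Rightarrow> nat \<Rightarrow> nat \<Rightarrow> rmax^'n^'n \<Rightarrow> bool" where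
  "is_CSR X t\<^sub>0 k \<Gamma> \<longleftrightarrow>
     \<Gamma> = CSR_C X t\<^sub>0 k \<Gamma> ** matpow (CSR_S X) (k mod CSR_gamma X) ** CSR_R X t\<^sub>0 k \<Gamma>"

section \<open>The two matrices\<close>

text \<open>The index type \<open>6\<close> has the six elements \<open>1, 2, 3, 4, 5, 6\<close> (where \<open>6 = 0\<close>).\<close>

definition A\<^sub>1 :: "rmax^6^6" where
  "A\<^sub>1 = (\<chi> i j.
     if (i, j) \<in> {(1, 2), (2, 1)} then Fin 0
     else if (i, j) \<in> {(1, 3), (2, 5), (3, 4), (4, 1), (5, 6), (6, 2)} then Fin (- 100)
     else \<epsilon>)"

definition A\<^sub>2 :: "rmax^6^6" where
  "A\<^sub>2 = (\<chi> i j.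
     if (i, j) \<in> {(1, 2), (2, 1)} then Fin 0
     else if (i, j) \<in> {(1, 3), (3, 4), (5, 6), (6, 2)} then Fin (- 100)
     else if (i, j) \<in> {(2, 5), (4, 1)} then Fin (- 1)
     else \<epsilon>)"

definition two_cycle :: "(6, 6 \<times> 6) pre_digraph" where
  "two_cycle = \<lparr>verts = {1, 2}, arcs = {(1, 2), (2, 1)}, tail = fst, head = snd\<rparr>"

end

(*
  Put G = A1^n A2 with n >= 2, so k = n + 1, and let i and j be the elements of {1,2} with i = 1
  iff n is even and j the other one. The parity of k makes the CSR product equal to G S^m G for
  some m for which S^m has the entry 0 at (1,j). Hence its entry (i,5) is at least
  G(i,1) + G(j,5) >= -201 - 1, where the last step of each factor uses one of the two cheap arcs
  (4,1), (2,5) of A2. In G itself only the last step uses a cheap arc: a walk from i that ends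
  with 2 -> 5 must reach 2 in n steps, and its parity then forces it through an additional
  3-cycle of A1, at cost 300, so that G(i,5) <= -301.
*)
theory Submission
  imports Defs
begin

section \<open>The order of the max-plus semiring\<close>

instantiation rmax :: linorder
begin

text \<open>The natural order of an idempotent addition: it is the usual order of the reals with
  \<epsilon> as least element. In this form its laws follow from those of \<open>+\<close>, and the
  library's monotonicity rules for ordered semirings become available.\<close>

definition less_eq_rmax :: "rmax \<Rightarrow> rmax \<Rightarrow> bool" where
  "a \<le> b \<longleftrightarrow> a + b = (b :: rmax)"

definition less_rmax :: "rmax \<Rightarrow> rmax \<Rightarrow> bool" where
  "a < b \<longleftrightarrow> a \<le> b \<and> \<not> b \<le> (a :: rmax)"

instance
proof
  fix a b c :: rmax
  show "a < b \<longleftrightarrow> a \<le> b \<and> \<not> b \<le> a" by (rule less_rmax_def)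
  show "a \<le> a" by (cases a) (auto simp: less_eq_rmax_def)
  show "a \<le> c" if "a \<le> b" "b \<le> c" using that by (metis less_eq_rmax_def add.assoc)
  show "a = b" if "a \<le> b" "b \<le> a" using that by (metis less_eq_rmax_def add.commute)
  show "a \<le> b \<or> b \<le> a" by (cases a; cases b) (auto simp: less_eq_rmax_def)
qed

end

lemma rmax_add_idem [simp]: "a + a = (a :: rmax)"
  by (cases a) auto

instance rmax :: canonically_ordered_monoid_add
proof
  fix a b :: rmax
  show "a \<le> b \<longleftrightarrow> (\<exists>c. b = a + c)"
    by (metis less_eq_rmax_def add.assoc rmax_add_idem)
qed

instance rmax :: ordered_comm_semiring
proof
  fix a b c :: rmax
  assume "a \<le> b"
  then show "c * a \<le> c * b"
    by (metis less_eq_rmax_def distrib_left)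
qed

lemma Eps_le [simp]: "\<epsilon> \<le> a"
  by (simp add: less_eq_rmax_def)

lemma Fin_le_Fin [simp]: "Fin a \<le> Fin b \<longleftrightarrow> a \<le> b"
  by (auto simp: less_eq_rmax_def)

lemma rmax_sum_le:
  fixes f :: "'b \<Rightarrow> rmax"
  assumes "\<And>x. x \<in> A \<Longrightarrow> f x \<le> c"
  shows "sum f A \<le> c"
  using assms
proof (induction A rule: infinite_finite_induct)
  case (insert x F)
  then show ?case by (auto simp: less_eq_rmax_def add.assoc)
qed (auto simp: zero_rmax_def less_eq_rmax_def)

section \<open>Bounds for the entries of matrix products\<close>

lemma entry_le_matrix_mult:
  fixes A :: "rmax^'n^'m" and B :: "rmax^'p^'n"
  assumes "a \<le> A $ i $ l" "b \<le> B $ l $ j"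
  shows "a * b \<le> (A ** B) $ i $ j"
proof -
  have "a * b \<le> A $ i $ l * B $ l $ j"
    \<comment> \<open>The nonnegativity conditions of \<open>mult_mono\<close> hold for all
      elements, since \<open>0\<close> is \<epsilon> here.\<close>
    using assms by (intro mult_mono) auto
  also have "\<dots> \<le> (A ** B) $ i $ j"
    unfolding matrix_matrix_mult_def vec_lambda_beta
    by (rule member_le_sum[where f = "\<lambda>k. A $ i $ k * B $ k $ j"]) auto
  finally show ?thesis .
qed

lemma matrix_mult_entry_le:
  fixes A :: "rmax^'n^'m" and B :: "rmax^'p^'n"
  assumes "\<And>l. A $ i $ l * B $ l $ j \<le> c"
  shows "(A ** B) $ i $ j \<le> c"
  unfolding matrix_matrix_mult_def using assms by (simp add: rmax_sum_le)

lemma matpow_add: "matpow A (m + n) = matpow A m ** matpow A n"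
  by (induction m) (simp_all add: matrix_mul_assoc matrix_mul_lid)

lemma matpow_mult_in_products:
  assumes "A \<in> X" "B \<in> X"
  shows "matpow A n ** B \<in> products X (Suc n)"
proof -
  have "foldr (**) (replicate n A @ [B]) (mat 1) = matpow A n ** B"
    by (induction n) (simp_all add: matrix_mul_assoc matrix_mul_lid matrix_mul_rid)
  then show ?thesis
    unfolding products_def using assms
    by (intro CollectI exI[of _ "replicate n A @ [B]"]) auto
qed

section \<open>The associated digraph and its primitivity\<close>

lemma exhaust_6:
  fixes x :: 6
  shows "x = 1 \<or> x = 2 \<or> x = 3 \<or> x = 4 \<or> x = 5 \<or> x = 6"
proof (induct x)
  case (of_int z)
  then have "z = 0 \<or> z = 1 \<or> z = 2 \<or> z = 3 \<or> z = 4 \<or> z = 5" by fastforce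
  then show ?case by auto
qed

lemma arcs_A1: "A\<^sub>1 $ i $ j \<noteq> \<epsilon> \<longleftrightarrow>
    (i, j) \<in> {(1, 2), (2, 1), (1, 3), (2, 5), (3, 4), (4, 1), (5, 6), (6, 2)}"
  by (auto simp: A\<^sub>1_def)

lemma arcs_A2: "A\<^sub>2 $ i $ j \<noteq> \<epsilon> \<longleftrightarrow>
    (i, j) \<in> {(1, 2), (2, 1), (1, 3), (2, 5), (3, 4), (4, 1), (5, 6), (6, 2)}"
  by (auto simp: A\<^sub>2_def)

lemma assoc_digraph_A1_eq_A2: "assoc_digraph A\<^sub>1 = assoc_digraph A\<^sub>2"
  by (simp add: assoc_digraph_def arcs_A1 arcs_A2)

lemma wf_digraph_assoc_digraph: "wf_digraph (assoc_digraph A)"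
  by unfold_locales (auto simp: assoc_digraph_def)

lemma assoc_digraph_reachable_step:
  assumes "A $ u $ v \<noteq> \<epsilon>" "v \<rightarrow>\<^sup>*\<^bsub>assoc_digraph A\<^esub> w"
  shows "u \<rightarrow>\<^sup>*\<^bsub>assoc_digraph A\<^esub> w"
proof -
  interpret wf_digraph "assoc_digraph A" by (rule wf_digraph_assoc_digraph)
  have "u \<rightarrow>\<^bsub>assoc_digraph A\<^esub> v"
    using assms(1) by (force simp: assoc_digraph_def arcs_ends_def arc_to_ends_def)
  then show ?thesis using assms(2) by (rule adj_reachable_trans)
qed

lemma strongly_connected_assoc_digraph_A1: "strongly_connected (assoc_digraph A\<^sub>1)"
proof -
  let ?R = "\<lambda>u v. u \<rightarrow>\<^sup>*\<^bsub>assoc_digraph A\<^sub>1\<^esub> v"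
  interpret wf_digraph "assoc_digraph A\<^sub>1" by (rule wf_digraph_assoc_digraph)
  have refl: "?R u u" for u by (rule reachable_refl) (simp add: assoc_digraph_def)
  note step = assoc_digraph_reachable_step[of A\<^sub>1]
  have e: "A\<^sub>1 $ 1 $ 2 \<noteq> \<epsilon>" "A\<^sub>1 $ 2 $ 1 \<noteq> \<epsilon>" "A\<^sub>1 $ 1 $ 3 \<noteq> \<epsilon>" "A\<^sub>1 $ 2 $ 5 \<noteq> \<epsilon>"
    "A\<^sub>1 $ 3 $ 4 \<noteq> \<epsilon>" "A\<^sub>1 $ 4 $ 1 \<noteq> \<epsilon>" "A\<^sub>1 $ 5 $ 6 \<noteq> \<epsilon>" "A\<^sub>1 $ 6 $ 2 \<noteq> \<epsilon>"
    by (simp_all add: arcs_A1)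
  \<comment> \<open>The arcs used here form a tree directed towards 1, and those used for
    \<open>from1\<close> a tree directed away from 1, so the repeated rule application searches for
    a walk without running in circles.\<close>
  have to1: "?R 1 1" "?R 2 1" "?R 4 1" "?R 3 1" "?R 6 1" "?R 5 1"
    by (rule refl step[OF e(2)] step[OF e(6)] step[OF e(5)] step[OF e(8)] step[OF e(7)])+
  have from1: "?R 1 2" "?R 1 3" "?R 1 4" "?R 1 5" "?R 1 6"
    by (rule refl step[OF e(3)] step[OF e(5)] step[OF e(1)] step[OF e(4)] step[OF e(7)])+
  have "?R u 1" "?R 1 u" for u
    using exhaust_6[of u] to1 from1 by auto
  then have "?R u v" for u v by (blast intro: reachable_trans)
  then show ?thesis unfolding strongly_connected_def by (simp add: assoc_digraph_def)
qed

lemma cyclicity_dvd_length: "pre_digraph.cycle G p \<Longrightarrow> cyclicity G dvd length p"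
  unfolding cyclicity_def by (rule Gcd_dvd) auto

text \<open>Besides strong connectivity, two cycles of coprime lengths suffice: one of length 2 and
  one of length 3, both through the node 1.\<close>

lemma primitive_assoc_digraph_A1: "primitive_digraph (assoc_digraph A\<^sub>1)"
proof -
  let ?G = "assoc_digraph A\<^sub>1"
  have "pre_digraph.cycle ?G [(1, 2), (2, 1)]" "pre_digraph.cycle ?G [(1, 3), (3, 4), (4, 1)]"
    by (auto simp: pre_digraph.cycle_def pre_digraph.awalk_def pre_digraph.cas.simps
        pre_digraph.awalk_verts.simps assoc_digraph_def arcs_A1)
  then have "cyclicity ?G dvd 2" "cyclicity ?G dvd 3"
    by (auto dest!: cyclicity_dvd_length simp: eval_nat_numeral)
  then have "cyclicity ?G dvd 3 - 2" by (rule dvd_diff_nat[rotated])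
  then show ?thesis
    using strongly_connected_assoc_digraph_A1 by (simp add: primitive_digraph_def)
qed

section \<open>The common critical digraph and its cyclicity\<close>

lemma critical_digraph_eq_two_cycle:
  fixes A :: "rmax^6^6"
  assumes nonpos: "\<And>i j. A $ i $ j \<le> 1"
    and zero: "\<And>i j. A $ i $ j = 1 \<longleftrightarrow> (i, j) \<in> {(1, 2), (2, 1)}"
  shows "critical_digraph A = two_cycle"
proof -
  let ?G = "assoc_digraph A" and ?w = "\<lambda>e. the_real (A $ fst e $ snd e)"
  let ?c = "[(1, 2), (2, 1)] :: (6 \<times> 6) list"
  have mean: "cycle_mean A p = (\<Sum>e\<leftarrow>p. ?w e) / real (length p)" for p
    by (simp add: cycle_mean_def case_prod_unfold)
  have w: "?w e \<le> 0" and w0: "?w e = 0 \<longleftrightarrow> e \<in> {(1, 2), (2, 1)}"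
    if "pre_digraph.cycle ?G p" "e \<in> set p" for p e
  proof -
    have "A $ fst e $ snd e \<noteq> \<epsilon>"
      using that by (auto simp: pre_digraph.cycle_def pre_digraph.awalk_def assoc_digraph_def)
    then obtain x where "A $ fst e $ snd e = Fin x"
      by (cases "A $ fst e $ snd e") auto
    then show "?w e \<le> 0" "?w e = 0 \<longleftrightarrow> e \<in> {(1, 2), (2, 1)}"
      using nonpos[of "fst e" "snd e"] zero[of "fst e" "snd e"] by (auto simp: one_rmax_def)
  qed
  have mean_le: "cycle_mean A p \<le> 0" if "pre_digraph.cycle ?G p" for p
    unfolding mean using w[OF that]
    by (intro divide_nonpos_nonneg sum_list_nonpos) auto
  have A12: "A $ 1 $ 2 = Fin 0" "A $ 2 $ 1 = Fin 0"
    using zero[of 1 2] zero[of 2 1] by (simp_all add: one_rmax_def)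
  have c: "pre_digraph.cycle ?G ?c"
    by (auto simp: pre_digraph.cycle_def pre_digraph.awalk_def pre_digraph.cas.simps
        pre_digraph.awalk_verts.simps assoc_digraph_def A12)
  have c0: "cycle_mean A ?c = 0"
    by (simp add: cycle_mean_def A12)
  have crit: "critical_cycle A ?c"
    using c c0 mean_le by (simp add: critical_cycle_def)
  \<comment> \<open>A critical cycle has mean at least that of \<open>?c\<close>, which is 0. As no
    arc has positive weight, all its arcs have weight 0.\<close>
  have only: "e \<in> {(1, 2), (2, 1)}" if "critical_cycle A p" "e \<in> set p" for p e
  proof -
    have p: "pre_digraph.cycle ?G p" "0 \<le> cycle_mean A p"
      using that(1) c c0 by (auto simp: critical_cycle_def)
    have "0 < real (length p)" using that(2) by (cases p) auto
    with p(2) have "0 \<le> (\<Sum>e\<leftarrow>p. ?w e)"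
      by (simp add: mean zero_le_divide_iff)
    \<comment> \<open>After negation all summands are nonnegative, so each of them is at most the
      total, which is at most 0.\<close>
    moreover have "(\<Sum>e\<leftarrow>p. - ?w e) = - (\<Sum>e\<leftarrow>p. ?w e)"
      by (simp add: uminus_sum_list_map comp_def)
    moreover have "- ?w e \<le> (\<Sum>e\<leftarrow>p. - ?w e)"
      using that(2) w[OF p(1)] by (intro member_le_sum_list) auto
    ultimately have "?w e = 0" using w[OF p(1) that(2)] by simp
    then show ?thesis using w0[OF p(1) that(2)] by simp
  qed
  have "{e. \<exists>p. critical_cycle A p \<and> e \<in> set p} = {(1, 2), (2, 1)}"
    using only crit by fastforce
  moreover have "{v. \<exists>p e. critical_cycle A p \<and> e \<in> set p \<and> (v = fst e \<or> v = snd e)} = {1, 2}"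
    using only crit by fastforce
  ultimately show ?thesis by (simp add: critical_digraph_def two_cycle_def)
qed

lemma critical_digraph_A1: "critical_digraph A\<^sub>1 = two_cycle"
  by (rule critical_digraph_eq_two_cycle) (simp_all add: A\<^sub>1_def one_rmax_def)

lemma critical_digraph_A2: "critical_digraph A\<^sub>2 = two_cycle"
  by (rule critical_digraph_eq_two_cycle) (simp_all add: A\<^sub>2_def one_rmax_def)

text \<open>The heads of the arcs of a cycle are pairwise distinct and lie in {1, 2}, so there are
  at most two arcs; a single arc would have to be a loop.\<close>

lemma cyclicity_two_cycle: "cyclicity two_cycle = 2"
proof -
  have arcs: "arcs two_cycle = {(1, 2), (2, 1)}" by (simp add: two_cycle_def)
  have "length p = 2" if cycle: "pre_digraph.cycle two_cycle p" for p
  proof -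
    obtain u where u: "pre_digraph.awalk two_cycle u p u"
      "distinct (tl (pre_digraph.awalk_verts two_cycle u p))" "p \<noteq> []"
      using cycle unfolding pre_digraph.cycle_def by blast
    have p: "set p \<subseteq> {(1, 2), (2, 1)}" "pre_digraph.cas two_cycle u p u"
      using u(1) unfolding pre_digraph.awalk_def arcs by simp_all
    have tl: "tl (pre_digraph.awalk_verts two_cycle u p) = map snd p"
      using p(2) u(3) by (simp add: pre_digraph.awalk_verts_conv' two_cycle_def)
    have "length p = card (snd ` set p)"
      using u(2) unfolding tl by (metis distinct_card length_map set_map)
    also have "\<dots> \<le> card {1, 2 :: 6}"
      using p(1) by (intro card_mono) auto
    finally have "length p \<le> 2" by simp
    moreover have "length p \<noteq> 1"
      using p(1,2) by (auto simp: length_Suc_conv pre_digraph.cas.simps two_cycle_def)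
    ultimately show ?thesis using u(3) by (cases p) (auto simp: le_Suc_eq)
  qed
  moreover have "pre_digraph.cycle two_cycle [(1, 2), (2, 1)]"
    by (auto simp: pre_digraph.cycle_def pre_digraph.awalk_def pre_digraph.cas.simps
        pre_digraph.awalk_verts.simps two_cycle_def)
  ultimately have "{length p | p. pre_digraph.cycle two_cycle p} = {2}"
    by force
  then show ?thesis by (simp add: cyclicity_def)
qed

lemma common_critical_digraph_A1_A2: "common_critical_digraph {A\<^sub>1, A\<^sub>2} = two_cycle"
  unfolding common_critical_digraph_def
  by (rule the_equality) (auto simp: critical_digraph_A1 critical_digraph_A2)

lemma CSR_gamma_A1_A2: "CSR_gamma {A\<^sub>1, A\<^sub>2} = 2"
  by (simp add: CSR_gamma_def common_critical_digraph_A1_A2 cyclicity_two_cycle)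

section \<open>Weights of walks and the failure of CSR\<close>

definition alt :: "nat \<Rightarrow> 6" where
  "alt n = (if even n then 1 else 2)"

text \<open>Walking around the critical cycle costs nothing, both in \<open>A\<^sub>1\<close> and in
  \<open>S\<close>. The node \<open>alt n\<close> is the one from which n steps around the cycle
  lead to 1; the offset \<open>m\<close> selects the end node.\<close>

lemma matpow_alt:
  assumes "1 \<le> A $ 1 $ 2" "1 \<le> A $ 2 $ 1"
  shows "1 \<le> matpow A n $ alt (n + m) $ alt m"
proof (induction n)
  case 0
  show ?case by (simp add: mat_def)
next
  case (Suc n)
  have "1 \<le> A $ alt (Suc n + m) $ alt (n + m)"
    using assms by (auto simp: alt_def)
  then have "1 * 1 \<le> (A ** matpow A n) $ alt (Suc n + m) $ alt m"
    using Suc by (rule entry_le_matrix_mult)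
  then show ?case by simp
qed

text \<open>
  The first summand is the largest weight of a walk from \<open>i\<close> to \<open>2\<close> in \<open>A\<^sub>1\<close>. Every arc except
  \<open>(1, 3)\<close> and \<open>(2, 5)\<close> alternates between \<open>{1, 3, 6}\<close> and \<open>{2, 4, 5}\<close>, so a walk whose length has
  the other parity contains an additional 3-cycle, at the price of \<open>300\<close>.
\<close>
definition col2_bound :: "nat \<Rightarrow> 6 \<Rightarrow> real" where
  "col2_bound n i =
     (if i \<in> {1, 2} then 0 else if i \<in> {3, 5} then - 200 else - 100) -
     (if even n \<longleftrightarrow> i \<in> {2, 4, 5} then 0 else 300)"

lemma matpow_A1_col2_le: "matpow A\<^sub>1 n $ i $ 2 \<le> Fin (col2_bound n i)"
proof (induction n arbitrary: i)
  case 0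
  show ?case
    by (auto simp: mat_def col2_bound_def one_rmax_def zero_rmax_def)
next
  case (Suc n)
  have "A\<^sub>1 $ i $ l * matpow A\<^sub>1 n $ l $ 2 \<le> Fin (col2_bound (Suc n) i)" for l
  proof -
    have "A\<^sub>1 $ i $ l * matpow A\<^sub>1 n $ l $ 2 \<le> A\<^sub>1 $ i $ l * Fin (col2_bound n l)"
      by (intro mult_mono Suc) auto
    \<comment> \<open>Checked arc by arc. The parity penalty is the same at both ends of every arc
      except \<open>(1, 3)\<close> and \<open>(2, 5)\<close>; for these two, the weight -100 and the
      first summand -200 at the head together account for the 300 of a new penalty.\<close>
    also have "\<dots> \<le> Fin (col2_bound (Suc n) i)"
      by (auto simp: A\<^sub>1_def col2_bound_def)
    finally show ?thesis .
  qed
  then show ?case by (simp add: matrix_mult_entry_le)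
qed

lemma not_is_CSR:
  assumes "2 \<le> n"
  shows "\<not> is_CSR {A\<^sub>1, A\<^sub>2} t\<^sub>0 (n + 1) (matpow A\<^sub>1 n ** A\<^sub>2)"
proof
  define G where "G = matpow A\<^sub>1 n ** A\<^sub>2"
  define S where "S = CSR_S {A\<^sub>1, A\<^sub>2}"
  define q where "q = (n + 1) mod 2"
  define a where "a = (t\<^sub>0 + 1) * 2 - q"
  define m where "m = a + q + a"
  assume "is_CSR {A\<^sub>1, A\<^sub>2} t\<^sub>0 (n + 1) (matpow A\<^sub>1 n ** A\<^sub>2)"
  then have "G = G ** matpow S a ** matpow S q ** (matpow S a ** G)"
    by (simp add: is_CSR_def CSR_C_def CSR_R_def CSR_gamma_A1_A2 G_def S_def q_def a_def)
  then have CSR: "G = G ** (matpow S m ** G)"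
    by (simp add: m_def matpow_add matrix_mul_assoc)
  \<comment> \<open>Since \<open>m\<close> is twice \<open>a\<close> plus \<open>q\<close>, it has
    the parity of \<open>n + 1\<close> whatever \<open>t\<^sub>0\<close> is.\<close>
  have m: "alt m = alt (n + 1)"
    by (auto simp: alt_def m_def a_def q_def)
  have A1: "1 \<le> A\<^sub>1 $ 1 $ 2" "1 \<le> A\<^sub>1 $ 2 $ 1"
    by (simp_all add: A\<^sub>1_def one_rmax_def)
  have S: "1 \<le> S $ 1 $ 2" "1 \<le> S $ 2 $ 1"
    by (simp_all add: S_def CSR_S_def common_critical_digraph_A1_A2 two_cycle_def one_rmax_def)
  have A2: "Fin (- 1) \<le> A\<^sub>2 $ 2 $ 5" "Fin (- 1) \<le> A\<^sub>2 $ 4 $ 1"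
    by (simp_all add: A\<^sub>2_def)

  have "Fin (- 200) \<le> matpow A\<^sub>1 n $ alt n $ 4"
  proof -
    \<comment> \<open>The walk spends its first n - 2 steps on the critical cycle, which ends at 1
      because n - 2 and n have the same parity, and then takes 1, 3, 4.\<close>
    obtain k where k: "n = k + 2" using assms by (metis add.commute le_Suc_ex)
    have "Fin (- 100) * (Fin (- 100) * 1) \<le> matpow A\<^sub>1 2 $ 1 $ 4"
      unfolding numeral_2_eq_2 matpow.simps
      by (intro entry_le_matrix_mult[where l = 3] entry_le_matrix_mult[where l = 4])
        (auto simp: A\<^sub>1_def mat_def)
    then have "Fin (- 200) \<le> matpow A\<^sub>1 2 $ alt 0 $ 4"
      by (simp add: alt_def one_rmax_def)
    with matpow_alt[OF A1, of k 0] show ?thesis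
      unfolding k matpow_add using entry_le_matrix_mult by (fastforce simp: alt_def)
  qed
  then have "Fin (- 200) * Fin (- 1) \<le> G $ alt n $ 1"
    unfolding G_def using A2(2) by (rule entry_le_matrix_mult)
  moreover have "1 \<le> matpow S m $ 1 $ alt (n + 1)"
    \<comment> \<open>The offset \<open>m\<close> makes the start \<open>alt (m + m)\<close>, which
      is 1, the node where the walk of the first factor ends.\<close>
    using matpow_alt[OF S, of m m] m by (simp add: alt_def)
  moreover have "1 \<le> matpow A\<^sub>1 n $ alt (n + 1) $ 2"
    using matpow_alt[OF A1, of n 1] by (simp add: alt_def)
  then have "1 * Fin (- 1) \<le> G $ alt (n + 1) $ 5"
    unfolding G_def using A2(1) by (rule entry_le_matrix_mult)
  ultimately have "(Fin (- 200) * Fin (- 1)) * (1 * (1 * Fin (- 1))) \<le> G $ alt n $ 5"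
    by (subst CSR) (intro entry_le_matrix_mult)
  then have lower: "Fin (- 202) \<le> G $ alt n $ 5"
    by (simp add: one_rmax_def)

  have "matpow A\<^sub>1 n $ alt n $ l * A\<^sub>2 $ l $ 5 \<le> Fin (- 301)" for l
  \<comment> \<open>The only arc of \<open>A\<^sub>2\<close> into 5 is
    \<open>(2, 5)\<close>.\<close>
  proof (cases "l = 2")
    case True
    have "matpow A\<^sub>1 n $ alt n $ 2 * A\<^sub>2 $ 2 $ 5 \<le> Fin (col2_bound n (alt n)) * Fin (- 1)"
      by (intro mult_mono matpow_A1_col2_le) (auto simp: A\<^sub>2_def)
    \<comment> \<open>For either parity of n, the node \<open>alt n\<close> has the wrong parity for
      reaching 2 in n steps, so the penalty 300 always applies.\<close>
    also have "\<dots> = Fin (- 301)" by (auto simp: col2_bound_def alt_def)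
    finally show ?thesis using True by simp
  next
    case False
    then show ?thesis by (cases "matpow A\<^sub>1 n $ alt n $ l") (simp_all add: A\<^sub>2_def)
  qed
  then have "G $ alt n $ 5 \<le> Fin (- 301)"
    unfolding G_def by (rule matrix_mult_entry_le)
  with lower have "Fin (- 202) \<le> Fin (- 301)" by (rule order_trans)
  then show False by simp
qed

theorem mainTheorem4:
  shows
    "assoc_digraph A\<^sub>1 = assoc_digraph A\<^sub>2 \<and> primitive_digraph (assoc_digraph A\<^sub>1) \<and>
     critical_digraph A\<^sub>1 = two_cycle \<and> critical_digraph A\<^sub>2 = two_cycle \<and> cyclicity two_cycle = 2 \<and>
     (\<forall>t\<^sub>0 t. CSR_admissible {A\<^sub>1, A\<^sub>2} t\<^sub>0 \<longrightarrow> 2 \<le> t \<longrightarrow>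
        \<not> is_CSR {A\<^sub>1, A\<^sub>2} t\<^sub>0 (2 * t + 1) (matpow A\<^sub>1 (2 * t) ** A\<^sub>2)) \<and>
     (\<forall>t\<^sub>0 t. CSR_admissible {A\<^sub>1, A\<^sub>2} t\<^sub>0 \<longrightarrow> 1 \<le> t \<longrightarrow>
        \<not> is_CSR {A\<^sub>1, A\<^sub>2} t\<^sub>0 (2 * t + 2) (matpow A\<^sub>1 (2 * t + 1) ** A\<^sub>2)) \<and>
     (\<forall>N. \<exists>k\<ge>N. \<exists>\<Gamma> \<in> products {A\<^sub>1, A\<^sub>2} k.
        \<forall>t\<^sub>0. CSR_admissible {A\<^sub>1, A\<^sub>2} t\<^sub>0 \<longrightarrow> \<not> is_CSR {A\<^sub>1, A\<^sub>2} t\<^sub>0 k \<Gamma>)"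
proof (intro conjI allI impI)
  fix t\<^sub>0 t :: nat
  show "\<not> is_CSR {A\<^sub>1, A\<^sub>2} t\<^sub>0 (2 * t + 1) (matpow A\<^sub>1 (2 * t) ** A\<^sub>2)" if "2 \<le> t"
    using that by (intro not_is_CSR) simp
  show "\<not> is_CSR {A\<^sub>1, A\<^sub>2} t\<^sub>0 (2 * t + 2) (matpow A\<^sub>1 (2 * t + 1) ** A\<^sub>2)" if "1 \<le> t"
    using that not_is_CSR[of "2 * t + 1"] by simp
next
  fix N :: nat
  have "matpow A\<^sub>1 (N + 2) ** A\<^sub>2 \<in> products {A\<^sub>1, A\<^sub>2} (N + 2 + 1)"
    using matpow_mult_in_products[of A\<^sub>1 "{A\<^sub>1, A\<^sub>2}" A\<^sub>2 "N + 2"] by simp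
  then show "\<exists>k\<ge>N. \<exists>\<Gamma> \<in> products {A\<^sub>1, A\<^sub>2} k.
      \<forall>t\<^sub>0. CSR_admissible {A\<^sub>1, A\<^sub>2} t\<^sub>0 \<longrightarrow> \<not> is_CSR {A\<^sub>1, A\<^sub>2} t\<^sub>0 k \<Gamma>"
    using not_is_CSR[of "N + 2"] by (intro exI[of _ "N + 2 + 1"]) auto
qed (fact assoc_digraph_A1_eq_A2 primitive_assoc_digraph_A1 critical_digraph_A1
    critical_digraph_A2 cyclicity_two_cycle)+

end
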